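(* In the setting described in the context, the coarse level matrix $$S_\Pi=A_{\Pi\Pi}-A_{\Pi r}A_{rr}^{-1}A_{r\Pi}$$ is symmetric positive definite, where $$A_{rr}=\begin{bmatrix} A_{II} & B_{II}^T & A_{I\Delta} \\ B_{II} & 0 & B_{I\Delta} \\ A_{\Delta I} & B_{I\Delta}^T & A_{\Delta\Delta} \end{bmatrix},\qquad A_{\Pi r}=A_{r\Pi}^T=\begin{bmatrix} A_{\Pi I} & B_{I\Pi}^T & A_{\Pi\Delta} \end{bmatrix}.$$
   Context: Discretization. $\Omega$ is a bounded polygonal domain in $\mathbb R^2$, triangulated into shape-regular triangles of characteristic size $h$. The pressure space $Q\subset L^2(\Omega)$ consists of the continuous piecewise linear functions on this triangulation. The velocity space $\mathbf W\subset (H^1_0(\Omega))^2$ consists of the continuous piecewise linear vector fields on the refined triangulation obtained by splitting each triangle into four by joining its edge midpoints. Functions are identified with their vectors of nodal values. The matrices $A$ and $B$ represent $a(\mathbf u,\mathbf v)=\int_\Omega\nabla\mathbf u\cdot\nabla\mathbf v$ on $\mathbf W$ and $b(\mathbf u,q)=-\int_\Omega(\nabla\cdot\mathbf u)q$ on $\mathbf W\times Q$. The pair $\mathbf W\times Q$ is inf-sup stable, and $\mathrm{Ker}(B^T)$ is the space of constant pressures. Decomposition. $\Omega$ is decomposed into $N$ non-overlapping polygonal subdomains $\Omega_i$, each a union of elements, with diameters of order $H$; nodes match across the interface $\Gamma=(\cup\partial\Omega_i)\setminus\partial\Omega$, which consists of subdomain edges and subdomain vertices. $\mathbf W=\mathbf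 W_I\oplus\mathbf W_\Gamma$ and $Q=Q_I\oplus Q_\Gamma$, where $\mathbf W_I=\bigoplus_i\mathbf W_I^{(i)}$, $Q_I=\bigoplus_iQ_I^{(i)}$ are subdomain-interior degrees of freedom and $\mathbf W_\Gamma$, $Q_\Gamma$ are the interface degrees of freedom, shared by neighboring subdomains. $\mathbf W_\Gamma$ is replaced by the partially assembled space $\widetilde{\mathbf W}_\Gamma=\mathbf W_\Pi\oplus\mathbf W_\Delta$, $\mathbf W_\Delta=\bigoplus_i\mathbf W_\Delta^{(i)}$. Here $\mathbf W_\Pi$ is the continuous coarse-level primal velocity space, typically spanned by subdomain vertex nodal basis functions and/or interface edge basis functions with constant values (or values of positive weights) on the edges. $\mathbf W_\Delta^{(i)}$ is spanned by the remaining (dual) interface velocity degrees of freedom of $\Omega_i$, with basis functions vanishing at the primal degrees of freedom; elements of $\mathbf W_\Delta$ may be discontinuous across $\Gamma$. Operators. Sub-blocks denote the subdomain-wise restrictions of $A$ and $B$ to the indicated subspaces, e.g. $A_{I\Delta}$ couples $\mathbf W_I$ and $\mathbf W_\Delta$, and $B_{I\Pi}$ couples $Q_I$ and $\mathbf W_\Pi$. The matrix $A_{rr}$ acts on $\mathbf W_I\oplus Q_I\oplus\mathbf W_\Delta$, represents independent subdomain problems, and is invertible; the full matrix $\widetilde A=\begin{bmatrix} A_{rr} & A_{r\Pi} \\ A_{\Pi r} & A_{\Pi\Pi} \end{bmatrix}$ on $\mathbf W_I\oplus Q_I\oplus\mathbf W_\Delta\oplus\mathbf W_\Pi$ is also invertible.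 *)

theory Defs
  imports "HOL-Analysis.Analysis" "Jordan_Normal_Form.Gauss_Jordan_Elimination"
begin

no_notation vec_nth (infixl \<open>$\<close> 90)

type_synonym point = "real^2"
type_synonym mesh = "point set set"
type_synonym pressure = "point \<Rightarrow> real"
type_synonym velocity = "point \<Rightarrow> real^2"

text \<open>Fields that may be discontinuous across the interface live on the disjoint union of the
  closed subdomains: \<open>u (i, x)\<close> is the value at \<open>x\<close> as seen from subdomain \<open>i\<close>, and \<open>curry u i\<close>
  is the field on subdomain \<open>i\<close>.\<close>

type_synonym broken_velocity = "nat \<times> point \<Rightarrow> real^2"


section \<open>Meshes and finite element spaces\<close>

text \<open>Elements are closed triangles. The library predicate \<open>triangulation\<close> provides finiteness and
  conformity (any two elements meet in a common, possibly empty, face).\<close>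

definition triangle_mesh :: "mesh \<Rightarrow> bool" where
  "triangle_mesh T \<longleftrightarrow> triangulation T \<and> T \<noteq> {} \<and> (\<forall>t\<in>T. 2 simplex t)"

definition mesh_domain :: "mesh \<Rightarrow> point set" where
  "mesh_domain T = interior (\<Union>T)"

definition triangulated_domain :: "point set \<Rightarrow> mesh \<Rightarrow> bool" where
  "triangulated_domain \<Omega> T \<longleftrightarrow> triangle_mesh T \<and> \<Omega> = mesh_domain T \<and> connected \<Omega>"

definition shape_regular :: "real \<Rightarrow> mesh \<Rightarrow> bool" where
  "shape_regular \<rho> T \<longleftrightarrow> (\<forall>t\<in>T. \<exists>x. cball x (\<rho> * diameter t) \<subseteq> t)"

definition size_of_order :: "real \<Rightarrow> real \<Rightarrow> real \<Rightarrow> point set \<Rightarrow> bool" where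
  "size_of_order c C h S \<longleftrightarrow> c * h \<le> diameter S \<and> diameter S \<le> C * h"

definition triangle_vertices :: "point set \<Rightarrow> point set" where
  "triangle_vertices t = {v. v extreme_point_of t}"

definition nodes :: "mesh \<Rightarrow> point set" where
  "nodes T = (\<Union>t\<in>T. triangle_vertices t)"

definition split_triangle :: "point set \<Rightarrow> mesh" where
  "split_triangle t =
     {convex hull {a, midpoint a b, midpoint a c} | a b c. triangle_vertices t = {a, b, c}} \<union>
     {convex hull {midpoint a b, midpoint b c, midpoint a c} | a b c. triangle_vertices t = {a, b, c}}"

definition refine_mesh :: "mesh \<Rightarrow> mesh" where
  "refine_mesh T = (\<Union>t\<in>T. split_triangle t)"

text \<open>Functions on the closed domain are extended by zero, so that they are determined by their
  values there.\<close>

definition P1 :: "mesh \<Rightarrow> (point \<Rightarrow> 'b::real_normed_vector) set" where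
  "P1 T = {f. continuous_on (\<Union>T) f \<and>
              (\<forall>t\<in>T. \<exists>L d. linear L \<and> (\<forall>x\<in>t. f x = L x + d)) \<and>
              (\<forall>x. x \<notin> \<Union>T \<longrightarrow> f x = 0)}"

definition pressure_space :: "mesh \<Rightarrow> pressure set" where
  "pressure_space T = P1 T"

definition velocity_space :: "mesh \<Rightarrow> velocity set" where
  "velocity_space T = {w \<in> P1 (refine_mesh T). \<forall>x \<in> frontier (mesh_domain T). w x = 0}"


section \<open>The Stokes forms\<close>

text \<open>A piecewise linear function is differentiable off the element boundaries, which are
  negligible, and its classical derivative is its weak derivative. The inner product of two
  Jacobians is the Frobenius product.\<close>

definition grad_form :: "point set \<Rightarrow> velocity \<Rightarrow> velocity \<Rightarrow> real" where
  "grad_form S u v = (LINT x:S|lebesgue. inner (jacobian u (at x)) (jacobian v (at x)))"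

definition div_form :: "point set \<Rightarrow> velocity \<Rightarrow> pressure \<Rightarrow> real" where
  "div_form S u q = - (LINT x:S|lebesgue. trace (jacobian u (at x)) * q x)"

text \<open>In the supremum \<open>w = 0\<close> contributes \<open>0 / 0 = 0\<close>, which is harmless because the quotient is
  odd in \<open>w\<close>. On the zero-trace space the \<open>H\<^sup>1\<close> seminorm is a norm.\<close>

definition inf_sup_stable :: "real \<Rightarrow> point set \<Rightarrow> velocity set \<Rightarrow> pressure set \<Rightarrow> bool" where
  "inf_sup_stable \<beta> \<Omega> W Q \<longleftrightarrow>
     (\<forall>q\<in>Q. (LINT x:\<Omega>|lebesgue. q x) = 0 \<longrightarrow>
        \<beta> * sqrt (LINT x:\<Omega>|lebesgue. (q x)\<^sup>2)
          \<le> (SUP w\<in>W. div_form \<Omega> w q / sqrt (grad_form \<Omega> w w)))"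

definition kernel_BT :: "point set \<Rightarrow> velocity set \<Rightarrow> pressure set \<Rightarrow> pressure set" where
  "kernel_BT \<Omega> W Q = {q \<in> Q. \<forall>w\<in>W. div_form \<Omega> w q = 0}"


section \<open>Domain decomposition\<close>

text \<open>Subdomain \<open>i\<close> is \<open>mesh_domain (Ts i)\<close> for \<open>i < N\<close>. Nodes match across the interface
  because all subdomain meshes are parts of one conforming mesh.\<close>

definition decomposition :: "mesh \<Rightarrow> nat \<Rightarrow> (nat \<Rightarrow> mesh) \<Rightarrow> bool" where
  "decomposition T N Ts \<longleftrightarrow>
     (\<Union>i<N. Ts i) = T \<and>
     (\<forall>i<N. \<forall>j<N. i \<noteq> j \<longrightarrow> Ts i \<inter> Ts j = {}) \<and>
     (\<forall>i<N. triangulated_domain (mesh_domain (Ts i)) (Ts i))"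

definition interface :: "mesh \<Rightarrow> nat \<Rightarrow> (nat \<Rightarrow> mesh) \<Rightarrow> point set" where
  "interface T N Ts = (\<Union>i<N. frontier (mesh_domain (Ts i))) - frontier (mesh_domain T)"

text \<open>A degree of freedom is interior to a subdomain iff no other subdomain shares its node. For
  nodes inside the domain this means lying off the interface. On the outer boundary, where
  only pressures have degrees of freedom, it separates the nodes owned by one subdomain from the
  ones shared by neighbouring subdomains.\<close>

definition interior_node :: "nat \<Rightarrow> (nat \<Rightarrow> mesh) \<Rightarrow> nat \<Rightarrow> point \<Rightarrow> bool" where
  "interior_node N Ts i x \<longleftrightarrow> x \<in> \<Union>(Ts i) \<and> (\<forall>j<N. j \<noteq> i \<longrightarrow> x \<notin> \<Union>(Ts j))"

definition W_I_local :: "mesh \<Rightarrow> nat \<Rightarrow> (nat \<Rightarrow> mesh) \<Rightarrow> nat \<Rightarrow> velocity set" where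
  "W_I_local T N Ts i =
     {w \<in> velocity_space T. \<forall>x \<in> nodes (refine_mesh T). \<not> interior_node N Ts i x \<longrightarrow> w x = 0}"

definition Q_I_local :: "mesh \<Rightarrow> nat \<Rightarrow> (nat \<Rightarrow> mesh) \<Rightarrow> nat \<Rightarrow> pressure set" where
  "Q_I_local T N Ts i =
     {q \<in> pressure_space T. \<forall>x \<in> nodes T. \<not> interior_node N Ts i x \<longrightarrow> q x = 0}"

definition W_I :: "mesh \<Rightarrow> nat \<Rightarrow> (nat \<Rightarrow> mesh) \<Rightarrow> velocity set" where
  "W_I T N Ts = {\<lambda>x. \<Sum>i<N. w i x | w. \<forall>i<N. w i \<in> W_I_local T N Ts i}"

definition Q_I :: "mesh \<Rightarrow> nat \<Rightarrow> (nat \<Rightarrow> mesh) \<Rightarrow> pressure set" where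
  "Q_I T N Ts = {\<lambda>x. \<Sum>i<N. q i x | q. \<forall>i<N. q i \<in> Q_I_local T N Ts i}"

definition W_Gamma :: "mesh \<Rightarrow> nat \<Rightarrow> (nat \<Rightarrow> mesh) \<Rightarrow> velocity set" where
  "W_Gamma T N Ts =
     {w \<in> velocity_space T. \<forall>x \<in> nodes (refine_mesh T). x \<notin> interface T N Ts \<longrightarrow> w x = 0}"

definition restrict_field :: "point set \<Rightarrow> velocity \<Rightarrow> velocity" where
  "restrict_field S w = (\<lambda>x. if x \<in> S then w x else 0)"

definition W_Gamma_local :: "mesh \<Rightarrow> nat \<Rightarrow> (nat \<Rightarrow> mesh) \<Rightarrow> nat \<Rightarrow> velocity set" where
  "W_Gamma_local T N Ts i = restrict_field (\<Union>(Ts i)) ` W_Gamma T N Ts"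

definition broken :: "nat \<Rightarrow> (nat \<Rightarrow> mesh) \<Rightarrow> velocity \<Rightarrow> broken_velocity" where
  "broken N Ts w = (\<lambda>(i, x). if i < N then restrict_field (\<Union>(Ts i)) w x else 0)"


section \<open>Primal and dual interface velocities\<close>

definition lin_comb :: "real vec \<Rightarrow> ('a \<Rightarrow> 'b::real_vector) list \<Rightarrow> 'a \<Rightarrow> 'b" where
  "lin_comb c bs = (\<lambda>x. \<Sum>k<length bs. (c $ k) *\<^sub>R (bs ! k) x)"

text \<open>Unique coordinates: this expresses spanning and linear independence at once.\<close>

definition is_basis :: "('a \<Rightarrow> 'b::real_vector) list \<Rightarrow> ('a \<Rightarrow> 'b) set \<Rightarrow> bool" where
  "is_basis bs V \<longleftrightarrow> bij_betw (\<lambda>c. lin_comb c bs) (carrier_vec (length bs)) V"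

text \<open>The degree of freedom with nodal weights \<open>\<gamma>\<close>. All linear functionals of the interface
  nodal values are of this form.\<close>

definition dof :: "mesh \<Rightarrow> nat \<Rightarrow> (nat \<Rightarrow> mesh) \<Rightarrow> velocity \<Rightarrow> velocity \<Rightarrow> real" where
  "dof T N Ts \<gamma> w = (\<Sum>x \<in> nodes (refine_mesh T) \<inter> interface T N Ts. inner (\<gamma> x) (w x))"

definition touches :: "(nat \<Rightarrow> mesh) \<Rightarrow> nat \<Rightarrow> velocity \<Rightarrow> bool" where
  "touches Ts i \<phi> \<longleftrightarrow> (\<exists>x \<in> \<Union>(Ts i). \<phi> x \<noteq> 0)"

text \<open>The primal degrees of freedom \<open>\<gamma> k\<close> are dual to the primal basis functions \<open>bP ! k\<close> and use
  only nodes common to all subdomains that \<open>bP ! k\<close> touches, so that each of these subdomains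
  can evaluate them and they agree for continuous fields. Typical choices, with \<open>e\<close> a
  coordinate vector: at a subdomain vertex \<open>v\<close>, \<open>bP ! k\<close> is the nodal basis function of \<open>v\<close> times
  \<open>e\<close> and \<open>\<gamma> k\<close> is \<open>e\<close> at \<open>v\<close> and \<open>0\<close> elsewhere; on a subdomain edge, \<open>bP ! k\<close> has nodal values
  \<open>\<omega> x *\<^sub>R e\<close>, \<open>\<omega> x > 0\<close>, at the nodes \<open>x\<close> in the relative interior of the edge and \<open>0\<close>
  elsewhere, and \<open>\<gamma> k\<close> is a correspondingly normalized (weighted) edge average of the \<open>e\<close>
  component.\<close>

definition primal_dofs ::
    "mesh \<Rightarrow> nat \<Rightarrow> (nat \<Rightarrow> mesh) \<Rightarrow> velocity set \<Rightarrow> velocity list \<Rightarrow> (nat \<Rightarrow> velocity) \<Rightarrow> bool" where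
  "primal_dofs T N Ts W_Pi bP \<gamma> \<longleftrightarrow>
     W_Pi \<subseteq> W_Gamma T N Ts \<and> is_basis bP W_Pi \<and>
     (\<forall>k<length bP. \<forall>l<length bP. dof T N Ts (\<gamma> k) (bP ! l) = (if k = l then 1 else 0)) \<and>
     (\<forall>k<length bP. \<forall>x \<in> nodes (refine_mesh T) \<inter> interface T N Ts. \<gamma> k x \<noteq> 0 \<longrightarrow>
        (\<forall>i<N. touches Ts i (bP ! k) \<longrightarrow> x \<in> \<Union>(Ts i)))"

definition W_Delta_local ::
    "mesh \<Rightarrow> nat \<Rightarrow> (nat \<Rightarrow> mesh) \<Rightarrow> velocity list \<Rightarrow> (nat \<Rightarrow> velocity) \<Rightarrow> nat \<Rightarrow> velocity set" where
  "W_Delta_local T N Ts bP \<gamma> i =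
     {w \<in> W_Gamma_local T N Ts i.
        \<forall>k<length bP. touches Ts i (bP ! k) \<longrightarrow> dof T N Ts (\<gamma> k) w = 0}"

definition W_Delta ::
    "mesh \<Rightarrow> nat \<Rightarrow> (nat \<Rightarrow> mesh) \<Rightarrow> velocity list \<Rightarrow> (nat \<Rightarrow> velocity) \<Rightarrow> broken_velocity set" where
  "W_Delta T N Ts bP \<gamma> =
     {u. (\<forall>i<N. curry u i \<in> W_Delta_local T N Ts bP \<gamma> i) \<and> (\<forall>i\<ge>N. \<forall>x. u (i, x) = 0)}"


section \<open>Matrices\<close>

text \<open>Blocks of \<open>A\<close> and \<open>B\<close>, assembled from subdomain contributions; rows belong to the first
  list of basis functions, columns to the second one.\<close>

definition A_block ::
    "nat \<Rightarrow> (nat \<Rightarrow> mesh) \<Rightarrow> broken_velocity list \<Rightarrow> broken_velocity list \<Rightarrow> real mat" where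
  "A_block N Ts us vs = Matrix.mat (length us) (length vs)
     (\<lambda>(k, l). \<Sum>i<N. grad_form (mesh_domain (Ts i)) (curry (us ! k) i) (curry (vs ! l) i))"

definition B_block ::
    "nat \<Rightarrow> (nat \<Rightarrow> mesh) \<Rightarrow> pressure list \<Rightarrow> broken_velocity list \<Rightarrow> real mat" where
  "B_block N Ts qs us = Matrix.mat (length qs) (length us)
     (\<lambda>(k, l). \<Sum>i<N. div_form (mesh_domain (Ts i)) (curry (us ! l) i) (qs ! k))"

definition append_cols :: "'a::zero mat \<Rightarrow> 'a mat \<Rightarrow> 'a mat" (infixr \<open>@\<^sub>c\<close> 66) where
  "A @\<^sub>c B = four_block_mat A B (0\<^sub>m 0 (dim_col A)) (0\<^sub>m 0 (dim_col B))"

definition A_rr ::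
    "nat \<Rightarrow> (nat \<Rightarrow> mesh) \<Rightarrow> broken_velocity list \<Rightarrow> pressure list \<Rightarrow> broken_velocity list \<Rightarrow> real mat" where
  "A_rr N Ts I Q D =
     (A_block N Ts I I @\<^sub>c transpose_mat (B_block N Ts Q I) @\<^sub>c A_block N Ts I D) @\<^sub>r
     (B_block N Ts Q I @\<^sub>c 0\<^sub>m (length Q) (length Q)         @\<^sub>c B_block N Ts Q D) @\<^sub>r
     (A_block N Ts D I @\<^sub>c transpose_mat (B_block N Ts Q D) @\<^sub>c A_block N Ts D D)"

definition A_Pi_r ::
    "nat \<Rightarrow> (nat \<Rightarrow> mesh) \<Rightarrow> broken_velocity list \<Rightarrow> pressure list \<Rightarrow> broken_velocity list
      \<Rightarrow> broken_velocity list \<Rightarrow> real mat" where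
  "A_Pi_r N Ts I Q D P =
     A_block N Ts P I @\<^sub>c transpose_mat (B_block N Ts Q P) @\<^sub>c A_block N Ts P D"

definition A_r_Pi ::
    "nat \<Rightarrow> (nat \<Rightarrow> mesh) \<Rightarrow> broken_velocity list \<Rightarrow> pressure list \<Rightarrow> broken_velocity list
      \<Rightarrow> broken_velocity list \<Rightarrow> real mat" where
  "A_r_Pi N Ts I Q D P = transpose_mat (A_Pi_r N Ts I Q D P)"

definition A_tilde ::
    "nat \<Rightarrow> (nat \<Rightarrow> mesh) \<Rightarrow> broken_velocity list \<Rightarrow> pressure list \<Rightarrow> broken_velocity list
      \<Rightarrow> broken_velocity list \<Rightarrow> real mat" where
  "A_tilde N Ts I Q D P =
     four_block_mat (A_rr N Ts I Q D) (A_r_Pi N Ts I Q D P)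
                    (A_Pi_r N Ts I Q D P) (A_block N Ts P P)"

definition S_Pi ::
    "nat \<Rightarrow> (nat \<Rightarrow> mesh) \<Rightarrow> broken_velocity list \<Rightarrow> pressure list \<Rightarrow> broken_velocity list
      \<Rightarrow> broken_velocity list \<Rightarrow> real mat" where
  "S_Pi N Ts I Q D P =
     A_block N Ts P P
       - A_Pi_r N Ts I Q D P * the (mat_inverse (A_rr N Ts I Q D)) * A_r_Pi N Ts I Q D P"

definition symmetric_positive_definite :: "real mat \<Rightarrow> bool" where
  "symmetric_positive_definite S \<longleftrightarrow>
     square_mat S \<and> transpose_mat S = S \<and>
     (\<forall>v \<in> carrier_vec (dim_row S). v \<noteq> 0\<^sub>v (dim_row S) \<longrightarrow> scalar_prod v (S *\<^sub>v v) > 0)"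

end

(* The number v^T S_Pi v is the value of the full quadratic form at (u, p, d, v), where (u, p, d)
   solves the eliminated equations. Those contain the divergence constraint tested with p, so the
   pressure terms drop out and v^T S_Pi v is the sum of the subdomain energies |grad|^2 of the broken
   velocity (u, d, v); hence S_Pi is positive semidefinite. A kernel vector of S_Pi would extend to a
   kernel vector of the invertible matrix A_tilde, so S_Pi is injective, and an injective symmetric
   positive semidefinite matrix is positive definite. *)

theory Submission
  imports Defs
begin

section \<open>Midpoint refinement, and integrability of products of Jacobians\<close>

section \<open>Piecewise affine fields\<close>

text \<open>By affine independence the extreme points of the hull are exactly the three spanning
  points, so the vertices used by \<open>split_triangle\<close> are the corners of the
  simplex.\<close>

lemma triangle_meshE:
  assumes "triangle_mesh T" "t \<in> T"
  obtains a b c where "t = convex hull {a, b, c}" "triangle_vertices t = {a, b, c}"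
proof -
  have "2 simplex t"
    using assms unfolding triangle_mesh_def by blast
  then obtain K where K: "\<not> affine_dependent K" "int (card K) = 3" "t = convex hull K"
    unfolding simplex_def by auto
  then have "card K = 3" by simp
  then obtain a b c where "K = {a, b, c}"
    by (auto simp: card_3_iff)
  moreover have "triangle_vertices t = K"
    unfolding triangle_vertices_def K(3)
    using extreme_point_of_convex_hull_affine_independent[OF K(1)] by auto
  ultimately show thesis
    using that K(3) by blast
qed

lemma finite_split_triangle:
  assumes "finite (triangle_vertices t)"
  shows "finite (split_triangle t)"
proof -
  let ?V = "triangle_vertices t"
  have "split_triangle t \<subseteq>
      (\<lambda>(a, b, c). convex hull {a, midpoint a b, midpoint a c}) ` (?V \<times> ?V \<times> ?V) \<union>
      (\<lambda>(a, b, c). convex hull {midpoint a b, midpoint b c, midpoint a c}) ` (?V \<times> ?V \<times> ?V)"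
    unfolding split_triangle_def by (fastforce simp: image_iff)
  then show ?thesis
    using assms by (auto intro: finite_subset)
qed

lemma finite_refine_mesh:
  assumes "triangle_mesh T"
  shows "finite (refine_mesh T)"
proof -
  have "finite T"
    using assms unfolding triangle_mesh_def triangulation_def by blast
  moreover have "finite (split_triangle t)" if "t \<in> T" for t
    by (rule triangle_meshE[OF assms that]) (auto intro: finite_split_triangle)
  ultimately show ?thesis
    unfolding refine_mesh_def by blast
qed

lemma refine_mesh_convex_compact:
  assumes "s \<in> refine_mesh T"
  shows "convex s" "compact s"
  using assms unfolding refine_mesh_def split_triangle_def
  by (auto intro: finite_imp_compact_convex_hull)

text \<open>In barycentric coordinates, a point with some coordinate at least \<open>1/2\<close>
  lies in the corner triangle at that vertex; if all three are below \<open>1/2\<close>, it lies in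
  the middle triangle.\<close>

lemma split_triangle_covers:
  assumes "t = convex hull {a, b, c}" "triangle_vertices t = {a, b, c}"
  shows "t \<subseteq> \<Union>(split_triangle t)"
proof
  \<comment> \<open>The labelling \<open>p, q, r\<close> is arbitrary, so that one computation
    serves all three corners.\<close>
  have corner: "x \<in> \<Union>(split_triangle t)"
    if x: "x = u *\<^sub>R p + v *\<^sub>R q + w *\<^sub>R r" "0 \<le> v" "0 \<le> w" "u + v + w = 1" "1/2 \<le> u"
      and pqr: "{p, q, r} = {a, b, c}" for x u v w p q r
  proof -
    \<comment> \<open>Each midpoint passes half of its weight to \<open>p\<close>. So the midpoints
      need the weights \<open>2 * v\<close> and \<open>2 * w\<close>, and \<open>2 * u - 1\<close>
      remains at \<open>p\<close>, nonnegative because \<open>1/2 \<le> u\<close>.\<close>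
    have "x = (2 * u - 1) *\<^sub>R p + (2 * v) *\<^sub>R midpoint p q + (2 * w) *\<^sub>R midpoint p r"
    proof -
      have "(2 * u - 1) *\<^sub>R p + (2 * v) *\<^sub>R midpoint p q + (2 * w) *\<^sub>R midpoint p r
          = (2 * u - 1 + v + w) *\<^sub>R p + v *\<^sub>R q + w *\<^sub>R r"
        by (simp add: midpoint_def algebra_simps)
      also have "2 * u - 1 + v + w = u"
        using x(4) by simp
      finally show ?thesis
        using x(1) by simp
    qed
    then have "x \<in> convex hull {p, midpoint p q, midpoint p r}"
      unfolding convex_hull_3 using x(2-5)
      by (intro CollectI exI[of _ "2 * u - 1"] exI[of _ "2 * v"] exI[of _ "2 * w"]) auto
    moreover have "convex hull {p, midpoint p q, midpoint p r} \<in> split_triangle t"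
      unfolding split_triangle_def
      by (intro UnI1 CollectI exI[of _ p] exI[of _ q] exI[of _ r]) (use pqr assms(2) in simp)
    ultimately show ?thesis
      by blast
  qed
  fix x assume "x \<in> t"
  then obtain u v w where uvw: "0 \<le> u" "0 \<le> v" "0 \<le> w" "u + v + w = 1"
    and x: "x = u *\<^sub>R a + v *\<^sub>R b + w *\<^sub>R c"
    unfolding assms(1) convex_hull_3 by blast
  consider "1/2 \<le> u" | "1/2 \<le> v" | "1/2 \<le> w" | "u < 1/2" "v < 1/2" "w < 1/2"
    by linarith
  then show "x \<in> \<Union>(split_triangle t)"
  proof cases
    case 1
    show ?thesis
      using corner[OF x] uvw 1 by simp
  next
    case 2
    show ?thesis
      using corner[of x v b u a w c] x uvw 2 by (simp add: algebra_simps insert_commute)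
  next
    case 3
    show ?thesis
      using corner[of x w c u a v b] x uvw 3 by (simp add: algebra_simps insert_commute)
  next
    case 4
    \<comment> \<open>A midpoint gets one minus twice the coordinate of the vertex opposite to its
      edge; these weights sum to \<open>3 - 2 = 1\<close> and are positive in this case.\<close>
    have "(1 - 2 * w) *\<^sub>R midpoint a b + (1 - 2 * u) *\<^sub>R midpoint b c + (1 - 2 * v) *\<^sub>R midpoint a c
        = (1 - w - v) *\<^sub>R a + (1 - w - u) *\<^sub>R b + (1 - u - v) *\<^sub>R c"
    proof -
      have "(1 - 2 * s) *\<^sub>R midpoint p q = (1/2 - s) *\<^sub>R p + (1/2 - s) *\<^sub>R q" for s :: real and p q :: point
        unfolding midpoint_def by (simp add: scaleR_add_right field_simps)
      moreover have "1 - w - v = (1/2 - w) + (1/2 - v)" "1 - w - u = (1/2 - w) + (1/2 - u)"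
          "1 - u - v = (1/2 - u) + (1/2 - v)"
        by simp_all
      ultimately show ?thesis
        by (simp only: scaleR_add_left add_ac)
    qed
    moreover have "1 - w - v = u" "1 - w - u = v" "1 - u - v = w"
      using uvw(4) by auto
    ultimately have "x = (1 - 2 * w) *\<^sub>R midpoint a b + (1 - 2 * u) *\<^sub>R midpoint b c + (1 - 2 * v) *\<^sub>R midpoint a c"
      using x by simp
    then have "x \<in> convex hull {midpoint a b, midpoint b c, midpoint a c}"
      unfolding convex_hull_3 using 4 uvw(4)
      by (intro CollectI exI[of _ "1 - 2 * w"] exI[of _ "1 - 2 * u"] exI[of _ "1 - 2 * v"]) auto
    moreover have "convex hull {midpoint a b, midpoint b c, midpoint a c} \<in> split_triangle t"
      unfolding split_triangle_def
      by (intro UnI2 CollectI exI[of _ a] exI[of _ b] exI[of _ c]) (use assms(2) in simp)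
    ultimately show ?thesis
      by blast
  qed
qed

lemma refine_mesh_covers:
  assumes "triangle_mesh T"
  shows "\<Union>T \<subseteq> \<Union>(refine_mesh T)"
proof -
  have "t \<subseteq> \<Union>(refine_mesh T)" if "t \<in> T" for t
  proof -
    have "t \<subseteq> \<Union>(split_triangle t)"
      using triangle_meshE[OF assms that] split_triangle_covers by metis
    also have "\<dots> \<subseteq> \<Union>(refine_mesh T)"
      using that unfolding refine_mesh_def by blast
    finally show ?thesis .
  qed
  then show ?thesis
    by blast
qed

definition pw_affine :: "mesh \<Rightarrow> velocity \<Rightarrow> bool" where
  "pw_affine M f \<longleftrightarrow> (\<forall>s\<in>M. \<exists>L d. linear L \<and> (\<forall>x\<in>s. f x = L x + d))"

lemma pw_affine_sum:
  assumes "\<And>i. i \<in> A \<Longrightarrow> pw_affine M (f i)"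
  shows "pw_affine M (\<lambda>x. \<Sum>i\<in>A. f i x)"
  unfolding pw_affine_def
proof
  fix s assume "s \<in> M"
  then have "\<forall>i\<in>A. \<exists>L d. linear L \<and> (\<forall>x\<in>s. f i x = L x + d)"
    using assms unfolding pw_affine_def by blast
  then obtain L d where "\<forall>i\<in>A. linear (L i) \<and> (\<forall>x\<in>s. f i x = L i x + d i)"
    by metis
  then have "linear (\<lambda>x. \<Sum>i\<in>A. L i x)" "\<forall>x\<in>s. (\<Sum>i\<in>A. f i x) = (\<Sum>i\<in>A. L i x) + (\<Sum>i\<in>A. d i)"
    by (auto intro: linear_compose_sum simp: sum.distrib)
  then show "\<exists>L d. linear L \<and> (\<forall>x\<in>s. (\<Sum>i\<in>A. f i x) = L x + d)"
    by (intro exI conjI)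
qed

text \<open>Differentiation is local: on the open set \<open>interior s \<inter> interior S\<close>
  the cut-off in \<open>restrict_field\<close> leaves the affine map unchanged, and the derivative
  of that map is \<open>L\<close>.\<close>

lemma jacobian_restrict_field_affine:
  assumes "linear L" "\<forall>x\<in>s. f x = L x + d" "x \<in> interior s \<inter> interior S"
  shows "jacobian (restrict_field S f) (at x) = matrix L"
proof -
  have "((\<lambda>x. L x + d) has_derivative L) (at x)"
    using assms(1) by (intro has_derivative_add_const linear_imp_has_derivative)
  then have "(restrict_field S f has_derivative L) (at x)"
  proof (rule has_derivative_transform_within_open)
    show "open (interior s \<inter> interior S)" "x \<in> interior s \<inter> interior S"
      using assms(3) by auto
    show "L y + d = restrict_field S f y" if "y \<in> interior s \<inter> interior S" for y
      using that assms(2) interior_subset[of s] interior_subset[of S]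
      unfolding restrict_field_def by auto
  qed
  then show ?thesis
    unfolding jacobian_def by (simp add: frechet_derivative_at[symmetric])
qed

text \<open>The Jacobians are constant on the open elements of a finite mesh, and the remaining boundary
  points are negligible.\<close>

lemma grad_form_integrable:
  assumes M: "finite M" "\<And>s. s \<in> M \<Longrightarrow> convex s" "\<And>s. s \<in> M \<Longrightarrow> compact s" "S \<subseteq> \<Union>M"
    and f: "pw_affine M f" and g: "pw_affine M g"
  shows "set_integrable lebesgue (interior S)
    (\<lambda>x. inner (jacobian (restrict_field S f) (at x)) (jacobian (restrict_field S g) (at x)))"
    (is "set_integrable lebesgue _ ?F")
proof -
  \<comment> \<open>Both Jacobians are constant on this set, which is open and bounded, hence of
    finite measure. The cut with \<open>interior S\<close> lets \<open>M\<close> be the mesh of a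
    larger region than \<open>S\<close>.\<close>
  have "set_integrable lebesgue (interior s \<inter> interior S) ?F" if s: "s \<in> M" for s
  proof -
    obtain L d where L: "linear L" "\<forall>x\<in>s. f x = L x + d"
      using f s unfolding pw_affine_def by blast
    obtain L' d' where L': "linear L'" "\<forall>x\<in>s. g x = L' x + d'"
      using g s unfolding pw_affine_def by blast
    have "bounded (interior s \<inter> interior S)"
      using M(3)[OF s] by (meson bounded_interior bounded_Int compact_imp_bounded)
    then have "interior s \<inter> interior S \<in> lmeasurable"
      by (intro lmeasurable_open) auto
    then have "set_integrable lebesgue (interior s \<inter> interior S) (\<lambda>x. inner (matrix L) (matrix L'))"
      by simp
    then show ?thesis
      by (rule set_integrable_cong[THEN iffD1, rotated -1])
        (auto simp: jacobian_restrict_field_affine[OF L] jacobian_restrict_field_affine[OF L'])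
  qed
  then have "set_integrable lebesgue (\<Union>s\<in>M. interior s \<inter> interior S) ?F"
    using M(1) by (intro set_integrable_UN) auto
  moreover have open_sets: "(\<Union>s\<in>M. interior s \<inter> interior S) \<in> sets lebesgue"
    using M(1) by (intro sets.finite_UN) auto
  moreover have null: "negligible (\<Union>s\<in>M. frontier s)"
    using M(1,2) by (auto intro!: negligible_Union negligible_convex_frontier)
  \<comment> \<open>Over a negligible set every function is integrable, whatever value
    \<open>jacobian\<close> takes where no derivative exists.\<close>
  moreover have "set_integrable lebesgue (\<Union>s\<in>M. frontier s) ?F"
    using null by (rule absolutely_integrable_negligible)
  ultimately have "set_integrable lebesgue ((\<Union>s\<in>M. interior s \<inter> interior S) \<union> (\<Union>s\<in>M. frontier s)) ?F"
    using negligible_imp_sets open_sets by (intro set_integrable_Un) blast+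
  moreover have cover: "interior S \<subseteq> (\<Union>s\<in>M. interior s \<inter> interior S) \<union> (\<Union>s\<in>M. frontier s)"
  proof
    fix x assume x: "x \<in> interior S"
    then obtain s where "s \<in> M" "x \<in> s"
      using M(4) interior_subset by blast
    then show "x \<in> (\<Union>s\<in>M. interior s \<inter> interior S) \<union> (\<Union>s\<in>M. frontier s)"
      using x closure_subset unfolding frontier_def by blast
  qed
  ultimately show ?thesis
    by (intro set_integrable_subset[OF _ _ cover]) auto
qed

section \<open>Inverses, definiteness and block elimination\<close>

section \<open>Schur complements\<close>

text \<open>A two-sided inverse makes \<open>A\<close> a unit of the matrix ring, and on units the
  partial function \<open>mat_inverse\<close> returns a result. This gives
  \<open>the (mat_inverse A)\<close> in \<open>S_Pi\<close> its meaning.\<close>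

lemma mat_inverse_invertible:
  fixes A :: "'a::field mat"
  assumes A: "A \<in> carrier_mat n n" and inv: "invertible_mat A"
  obtains B where "mat_inverse A = Some B" "B \<in> carrier_mat n n" "A * B = 1\<^sub>m n" "B * A = 1\<^sub>m n"
proof -
  obtain B where "inverts_mat A B" "inverts_mat B A"
    using inv unfolding invertible_mat_def by blast
  then have AB: "A * B = 1\<^sub>m n" and BA: "B * A = 1\<^sub>m (dim_row B)"
    using A unfolding inverts_mat_def by auto
  \<comment> \<open>\<open>inverts_mat\<close> does not fix the format of \<open>B\<close>; it is
    read off from the dimensions of the two products.\<close>
  have "dim_col B = n"
    using arg_cong[OF AB, of dim_col] by simp
  moreover have "dim_row B = n"
    using arg_cong[OF BA, of dim_col] A by simp
  ultimately have B: "B \<in> carrier_mat n n"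
    by auto
  then have "A \<in> Units (ring_mat TYPE('a) n ())"
    using A AB BA \<open>dim_row B = n\<close> unfolding Units_def ring_mat_def by auto
  then obtain B' where "mat_inverse A = Some B'"
    using mat_inverse(1)[OF A, where b = "()"] by blast
  then show thesis
    using mat_inverse(2)[OF A] that by blast
qed

lemma invertible_mat_inj:
  fixes A :: "'a::field mat"
  assumes "A \<in> carrier_mat n n" "invertible_mat A" "x \<in> carrier_vec n" "A *\<^sub>v x = 0\<^sub>v n"
  shows "x = 0\<^sub>v n"
proof -
  obtain B where B: "B \<in> carrier_mat n n" "B * A = 1\<^sub>m n"
    using mat_inverse_invertible assms(1,2) by blast
  have "x = (B * A) *\<^sub>v x"
    using assms B by simp
  also have "\<dots> = B *\<^sub>v (A *\<^sub>v x)"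
    using assms B by (intro assoc_mult_mat_vec) auto
  finally show ?thesis
    using assms B by auto
qed

text \<open>Transposing \<open>A * B = 1\<^sub>m n\<close> shows \<open>transpose_mat B\<close> to
  be a left inverse of \<open>A\<close>, and a left inverse equals the right inverse
  \<open>B\<close>.\<close>

lemma transpose_inverse_symmetric:
  fixes A :: "'a::field mat"
  assumes A: "A \<in> carrier_mat n n" "transpose_mat A = A"
    and B: "B \<in> carrier_mat n n" "A * B = 1\<^sub>m n" "B * A = 1\<^sub>m n"
  shows "transpose_mat B = B"
proof -
  have "transpose_mat B * A = 1\<^sub>m n"
    using transpose_mult[OF A(1) B(1)] A(2) B(2) by simp
  then have "transpose_mat B * A * B = B"
    using B(1) by simp
  moreover have "transpose_mat B * A * B = transpose_mat B * (A * B)"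
    using A B by (intro assoc_mult_mat) auto
  ultimately show ?thesis
    using B by simp
qed

lemma symmetric_scalar_prod_commute:
  fixes S :: "'a::comm_semiring_0 mat"
  assumes "S \<in> carrier_mat n n" "transpose_mat S = S" "v \<in> carrier_vec n" "w \<in> carrier_vec n"
  shows "scalar_prod w (S *\<^sub>v v) = scalar_prod v (S *\<^sub>v w)"
proof -
  have "scalar_prod w (S *\<^sub>v v) = scalar_prod (S *\<^sub>v w) v"
    using transpose_vec_mult_scalar[OF assms(1,3,4)] assms(2) by simp
  also have "\<dots> = scalar_prod v (S *\<^sub>v w)"
    using assms by (intro comm_scalar_prod[of _ n]) auto
  finally show ?thesis .
qed

text \<open>A vector \<open>v\<close> at which the form vanishes minimizes it. Moving by
  \<open>t\<close> along \<open>w = S *\<^sub>v v\<close> gives the value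
  \<open>2 * t * b + t\<^sup>2 * a\<close> with \<open>b\<close> the squared norm of
  \<open>w\<close>, which is negative for some negative \<open>t\<close> unless \<open>w\<close>
  vanishes; injectivity then gives \<open>v = 0\<^sub>v n\<close>.\<close>

lemma injective_positive_semidefinite:
  fixes S :: "real mat"
  assumes S: "S \<in> carrier_mat n n" "transpose_mat S = S"
    and nonneg: "\<And>v. v \<in> carrier_vec n \<Longrightarrow> 0 \<le> scalar_prod v (S *\<^sub>v v)"
    and inj: "\<And>v. v \<in> carrier_vec n \<Longrightarrow> S *\<^sub>v v = 0\<^sub>v n \<Longrightarrow> v = 0\<^sub>v n"
  shows "symmetric_positive_definite S"
proof -
  have "0 < scalar_prod v (S *\<^sub>v v)" if v: "v \<in> carrier_vec n" and nz: "v \<noteq> 0\<^sub>v n" for v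
  proof (rule ccontr)
    assume "\<not> 0 < scalar_prod v (S *\<^sub>v v)"
    then have vSv: "scalar_prod v (S *\<^sub>v v) = 0"
      using nonneg[OF v] by simp
    define w where "w = S *\<^sub>v v"
    have w: "w \<in> carrier_vec n"
      using S v unfolding w_def by simp
    define a where "a = scalar_prod w (S *\<^sub>v w)"
    define b where "b = scalar_prod w w"
    have quadratic: "0 \<le> 2 * t * b + t\<^sup>2 * a" for t
    proof -
      have Sadd: "S *\<^sub>v (v + t \<cdot>\<^sub>v w) = w + t \<cdot>\<^sub>v (S *\<^sub>v w)"
        using S v w by (simp add: mult_add_distrib_mat_vec[of _ n n] mult_mat_vec w_def)
      have Sw: "S *\<^sub>v w \<in> carrier_vec n"
        using S w by simp
      have "scalar_prod (v + t \<cdot>\<^sub>v w) (S *\<^sub>v (v + t \<cdot>\<^sub>v w))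
          = scalar_prod v w + t * scalar_prod v (S *\<^sub>v w)
            + (t * scalar_prod w w + t * (t * scalar_prod w (S *\<^sub>v w)))"
        unfolding Sadd using v w Sw
        by (simp add: add_scalar_prod_distrib[of _ n] scalar_prod_add_distrib[of _ n] algebra_simps)
      moreover have "scalar_prod v (S *\<^sub>v w) = b"
        using symmetric_scalar_prod_commute[OF S w v] unfolding b_def w_def .
      moreover have "scalar_prod v w = 0"
        using vSv unfolding w_def .
      ultimately show ?thesis
        using nonneg[of "v + t \<cdot>\<^sub>v w"] v w unfolding a_def b_def
        by (simp add: power2_eq_square algebra_simps)
    qed
    have "0 \<le> a"
      unfolding a_def using nonneg w by simp
    have "b \<le> 0"
    proof (rule ccontr)
      assume "\<not> b \<le> 0"
      then have "0 < b" by simp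
      \<comment> \<open>The choice is \<open>t = - (s * b)\<close>, close to the minimizer
        \<open>- b / a\<close> of the quadratic; adding one to \<open>a\<close> covers the case
        \<open>a = 0\<close>.\<close>
      define s where "s = 1 / (a + 1)"
      have "0 < s" "s * a = 1 - s"
        using \<open>0 \<le> a\<close> unfolding s_def by (auto simp: field_simps)
      have "0 \<le> 2 * (- (s * b)) * b + (- (s * b))\<^sup>2 * a"
        by (rule quadratic)
      also have "\<dots> = s * b\<^sup>2 * (s * a - 2)"
        by (simp add: power2_eq_square algebra_simps)
      also have "\<dots> = - (s * b\<^sup>2 * (1 + s))"
        unfolding \<open>s * a = 1 - s\<close> by (simp add: algebra_simps)
      also have "\<dots> < 0"
        using \<open>0 < s\<close> \<open>0 < b\<close> by simp
      finally show False by simp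
    qed
    then have "w = 0\<^sub>v n"
      using w conjugate_square_eq_0_vec[of w n] conjugate_square_ge_0_vec[of w]
      unfolding b_def by simp
    then show False
      using inj[OF v] nz unfolding w_def by simp
  qed
  then show ?thesis
    using S unfolding symmetric_positive_definite_def by auto
qed

text \<open>The block \<open>A\<close> may be indefinite, as in saddle-point problems. Positivity is
  therefore asked on the pairs \<open>y\<close>, \<open>v\<close> that solve the eliminated
  equations; there the second block row equals the Schur complement applied to
  \<open>v\<close>.\<close>

lemma schur_complement_positive_definite:
  fixes A R P :: "real mat"
  assumes A: "A \<in> carrier_mat n n" "transpose_mat A = A" "invertible_mat A"
    and R: "R \<in> carrier_mat m n"
    and P: "P \<in> carrier_mat m m" "transpose_mat P = P"
    and full: "invertible_mat (four_block_mat A (transpose_mat R) R P)"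
    and nonneg: "\<And>y v. y \<in> carrier_vec n \<Longrightarrow> v \<in> carrier_vec m \<Longrightarrow>
        A *\<^sub>v y + transpose_mat R *\<^sub>v v = 0\<^sub>v n \<Longrightarrow> 0 \<le> scalar_prod v (R *\<^sub>v y + P *\<^sub>v v)"
  shows "symmetric_positive_definite (P - R * the (mat_inverse A) * transpose_mat R)"
proof -
  obtain B where B: "mat_inverse A = Some B" "B \<in> carrier_mat n n" "A * B = 1\<^sub>m n" "B * A = 1\<^sub>m n"
    using mat_inverse_invertible A(1,3) by blast
  have Rt: "transpose_mat R \<in> carrier_mat n m"
    using R by simp
  define S where "S = P - R * B * transpose_mat R"
  have S: "S \<in> carrier_mat m m"
    using P R B(2) unfolding S_def by auto
  have "transpose_mat (R * B * transpose_mat R) = transpose_mat (transpose_mat R) * transpose_mat (R * B)"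
    using R B(2) by (intro transpose_mult[of _ m n _ m]) auto
  also have "\<dots> = R * (transpose_mat B * transpose_mat R)"
    using transpose_mult[OF R B(2)] by simp
  also have "\<dots> = R * B * transpose_mat R"
    using R B(2) transpose_inverse_symmetric[OF A(1,2) B(2-4)] by simp
  finally have "transpose_mat S = S"
    using P R B(2) unfolding S_def by (simp add: transpose_minus[of _ m m])
  \<comment> \<open>Solving the first block row gives \<open>y = - (B *\<^sub>v g)\<close> with
    \<open>g = transpose_mat R *\<^sub>v v\<close>; inserted in the second row it leaves the Schur
    complement.\<close>
  have elimination: "\<exists>y \<in> carrier_vec n. A *\<^sub>v y + transpose_mat R *\<^sub>v v = 0\<^sub>v n \<and> R *\<^sub>v y + P *\<^sub>v v = S *\<^sub>v v"
    if v: "v \<in> carrier_vec m" for v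
  proof -
    define g where "g = transpose_mat R *\<^sub>v v"
    have g: "g \<in> carrier_vec n"
      using Rt v unfolding g_def by simp
    define y where "y = - (B *\<^sub>v g)"
    have y: "y \<in> carrier_vec n"
      using B(2) g unfolding y_def by simp
    have "A *\<^sub>v (B *\<^sub>v g) = g"
      using assoc_mult_mat_vec[OF A(1) B(2) g] B(3) g by simp
    moreover have "A *\<^sub>v y = - (A *\<^sub>v (B *\<^sub>v g))"
      using A(1) B(2) g unfolding y_def by (intro eq_vecI) auto
    ultimately have "A *\<^sub>v y + g = 0\<^sub>v n"
      using g by simp
    moreover have "S *\<^sub>v v = P *\<^sub>v v - R *\<^sub>v (B *\<^sub>v g)"
      using P R B(2) v g unfolding S_def g_def
      by (simp add: minus_mult_distrib_mat_vec[of _ m m] assoc_mult_mat_vec[of _ m n _ m]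
        assoc_mult_mat_vec[of _ m n _ n])
    moreover have "R *\<^sub>v y = - (R *\<^sub>v (B *\<^sub>v g))"
      using R B(2) g unfolding y_def by (intro eq_vecI) auto
    ultimately have "R *\<^sub>v y + P *\<^sub>v v = S *\<^sub>v v"
      using R P v B(2) g by (intro eq_vecI) auto
    with \<open>A *\<^sub>v y + g = 0\<^sub>v n\<close> show ?thesis
      using y unfolding g_def by blast
  qed
  have "0 \<le> scalar_prod v (S *\<^sub>v v)" if "v \<in> carrier_vec m" for v
    using elimination[OF that] nonneg[OF _ that] by metis
  moreover have "v = 0\<^sub>v m" if v: "v \<in> carrier_vec m" and Sv: "S *\<^sub>v v = 0\<^sub>v m" for v
  proof -
    obtain y where y: "y \<in> carrier_vec n" "A *\<^sub>v y + transpose_mat R *\<^sub>v v = 0\<^sub>v n"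
      "R *\<^sub>v y + P *\<^sub>v v = 0\<^sub>v m"
      using elimination[OF v] Sv by metis
    have "four_block_mat A (transpose_mat R) R P *\<^sub>v (y @\<^sub>v v) = 0\<^sub>v n @\<^sub>v 0\<^sub>v m"
      using four_block_mat_mult_vec[OF A(1) Rt R P(1) y(1) v] y(2,3) by simp
    also have "\<dots> = 0\<^sub>v (n + m)"
      by (intro eq_vecI) auto
    finally have "y @\<^sub>v v = 0\<^sub>v (n + m)"
      using invertible_mat_inj[OF _ full, of "n + m"] A P y v by auto
    also have "\<dots> = 0\<^sub>v n @\<^sub>v 0\<^sub>v m"
      by (intro eq_vecI) auto
    finally show ?thesis
      using append_vec_eq[OF y(1)] v by auto
  qed
  ultimately have "symmetric_positive_definite S"
    by (intro injective_positive_semidefinite[OF S \<open>transpose_mat S = S\<close>]) auto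
  then show ?thesis
    unfolding S_def B(1) by simp
qed

section \<open>Algebra of horizontal and vertical concatenation\<close>

section \<open>Assembled matrices\<close>

lemma append_cols_carrier:
  "A \<in> carrier_mat n a \<Longrightarrow> B \<in> carrier_mat n b \<Longrightarrow> A @\<^sub>c B \<in> carrier_mat n (a + b)"
  unfolding append_cols_def by auto

lemma append_cols_mult_vec:
  fixes A B :: "'a::comm_semiring_1 mat"
  assumes A: "A \<in> carrier_mat n a" and B: "B \<in> carrier_mat n b"
    and x: "x \<in> carrier_vec a" and y: "y \<in> carrier_vec b"
  shows "(A @\<^sub>c B) *\<^sub>v (x @\<^sub>v y) = A *\<^sub>v x + B *\<^sub>v y"
proof -
  have "(A @\<^sub>c B) *\<^sub>v (x @\<^sub>v y) = (A *\<^sub>v x + B *\<^sub>v y) @\<^sub>v (0\<^sub>m 0 a *\<^sub>v x + 0\<^sub>m 0 b *\<^sub>v y)"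
    unfolding append_cols_def using A B four_block_mat_mult_vec[OF A B _ _ x y, of "0\<^sub>m 0 a" 0 "0\<^sub>m 0 b"]
    by auto
  \<comment> \<open>\<open>@\<^sub>c\<close> is encoded with an empty lower block row, so the
    product carries an appended vector of length zero.\<close>
  also have "\<dots> = A *\<^sub>v x + B *\<^sub>v y"
    by (intro eq_vecI) auto
  finally show ?thesis .
qed

lemma transpose_append_cols:
  assumes "A \<in> carrier_mat n a" "B \<in> carrier_mat n b"
  shows "transpose_mat (A @\<^sub>c B) = transpose_mat A @\<^sub>r transpose_mat B"
  unfolding append_cols_def append_rows_def using assms
  by (subst transpose_four_block_mat[of _ n a _ b _ 0]) auto

lemma transpose_append_rows:
  assumes "A \<in> carrier_mat a n" "B \<in> carrier_mat b n"
  shows "transpose_mat (A @\<^sub>r B) = transpose_mat A @\<^sub>c transpose_mat B"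
  unfolding append_cols_def append_rows_def using assms
  by (subst transpose_four_block_mat[of _ a n _ 0 _ b]) auto

text \<open>The interchange law of the two concatenations, which regroups a row of columns as a
  column of rows; the symmetry of \<open>A_rr\<close> rests on it.\<close>

lemma append_cols_append_rows:
  assumes "A \<in> carrier_mat a c" "B \<in> carrier_mat a d" "A' \<in> carrier_mat b c" "B' \<in> carrier_mat b d"
  shows "(A @\<^sub>r A') @\<^sub>c (B @\<^sub>r B') = (A @\<^sub>c B) @\<^sub>r (A' @\<^sub>c B')"
  using assms by (intro eq_matI) (auto simp: append_cols_def append_rows_def)

section \<open>Stiffness blocks as Gram matrices\<close>

lemma A_block_carrier: "A_block N Ts us vs \<in> carrier_mat (length us) (length vs)"
  unfolding A_block_def by simp

lemma B_block_carrier: "B_block N Ts qs us \<in> carrier_mat (length qs) (length us)"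
  unfolding B_block_def by simp

lemma A_block_index:
  "k < length us \<Longrightarrow> l < length vs \<Longrightarrow> A_block N Ts us vs $$ (k, l) =
    (\<Sum>i<N. grad_form (mesh_domain (Ts i)) (curry (us ! k) i) (curry (vs ! l) i))"
  unfolding A_block_def by simp

lemma grad_form_commute: "grad_form S u v = grad_form S v u"
  unfolding grad_form_def by (simp add: inner_commute)

lemma transpose_A_block: "transpose_mat (A_block N Ts us vs) = A_block N Ts vs us"
  by (intro eq_matI) (auto simp: A_block_def grad_form_commute)

lemma A_block_append_rows: "A_block N Ts (us @ us') vs = A_block N Ts us vs @\<^sub>r A_block N Ts us' vs"
  by (intro eq_matI) (auto simp: A_block_def append_rows_def nth_append)

lemma A_block_append_cols: "A_block N Ts us (vs @ vs') = A_block N Ts us vs @\<^sub>c A_block N Ts us vs'"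
  by (intro eq_matI) (auto simp: A_block_def append_cols_def nth_append)

text \<open>The double sum integrates the squared Frobenius norm of the combined Jacobians.
  Combining Jacobians, and not fields, keeps the pointwise identity valid also where a field has no
  derivative.\<close>

lemma grad_form_gram_nonneg:
  fixes c :: "nat \<Rightarrow> real"
  assumes int: "\<And>k l. k < n \<Longrightarrow> l < n \<Longrightarrow>
    set_integrable lebesgue S (\<lambda>x. inner (jacobian (u k) (at x)) (jacobian (u l) (at x)))"
  shows "0 \<le> (\<Sum>k<n. \<Sum>l<n. c k * c l * grad_form S (u k) (u l))"
proof -
  let ?F = "\<lambda>k l x. indicat_real S x *\<^sub>R inner (jacobian (u k) (at x)) (jacobian (u l) (at x))"
  have F: "integrable lebesgue (?F k l)" if "k < n" "l < n" for k l
    using int[OF that] unfolding set_integrable_def .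
  have "(\<Sum>k<n. \<Sum>l<n. c k * c l * grad_form S (u k) (u l))
      = (\<Sum>k<n. \<Sum>l<n. LINT x|lebesgue. c k * c l * ?F k l x)"
    unfolding grad_form_def set_lebesgue_integral_def by (simp only: integral_mult_right_zero)
  also have "\<dots> = (\<Sum>k<n. LINT x|lebesgue. (\<Sum>l<n. c k * c l * ?F k l x))"
    using F by (intro sum.cong refl Bochner_Integration.integral_sum[symmetric] integrable_mult_right) auto
  also have "\<dots> = (LINT x|lebesgue. (\<Sum>k<n. \<Sum>l<n. c k * c l * ?F k l x))"
    using F by (intro Bochner_Integration.integral_sum[symmetric] Bochner_Integration.integrable_sum
        integrable_mult_right) auto
  also have "\<dots> = (LINT x|lebesgue. indicat_real S x *
      inner (\<Sum>k<n. c k *\<^sub>R jacobian (u k) (at x)) (\<Sum>l<n. c l *\<^sub>R jacobian (u l) (at x)))"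
    by (intro arg_cong[where f = "integral\<^sup>L lebesgue"] ext)
      (simp add: inner_sum_left inner_sum_right sum_distrib_left inner_commute mult_ac)
  also have "0 \<le> \<dots>"
    by (intro Bochner_Integration.integral_nonneg) simp
  finally show ?thesis .
qed

text \<open>With the sum over subdomains moved outermost, each summand is a Gram form on one
  subdomain with the coefficients \<open>v\<close>.\<close>

lemma A_block_positive_semidefinite:
  assumes int: "\<And>i u w. i < N \<Longrightarrow> u \<in> set us \<Longrightarrow> w \<in> set us \<Longrightarrow>
      set_integrable lebesgue (mesh_domain (Ts i))
        (\<lambda>x. inner (jacobian (curry u i) (at x)) (jacobian (curry w i) (at x)))"
    and v: "v \<in> carrier_vec (length us)"
  shows "0 \<le> scalar_prod v (A_block N Ts us us *\<^sub>v v)"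
proof -
  let ?n = "length us"
  let ?a = "\<lambda>i k l. grad_form (mesh_domain (Ts i)) (curry (us ! k) i) (curry (us ! l) i)"
  have "scalar_prod v (A_block N Ts us us *\<^sub>v v) = (\<Sum>k<?n. \<Sum>l<?n. \<Sum>i<N. v $ k * v $ l * ?a i k l)"
    using v A_block_carrier[of N Ts us us]
    by (simp add: scalar_prod_def A_block_index atLeast0LessThan sum_distrib_left sum_distrib_right mult_ac)
  also have "\<dots> = (\<Sum>k<?n. \<Sum>i<N. \<Sum>l<?n. v $ k * v $ l * ?a i k l)"
    by (intro sum.cong refl sum.swap)
  also have "\<dots> = (\<Sum>i<N. \<Sum>k<?n. \<Sum>l<?n. v $ k * v $ l * ?a i k l)"
    by (rule sum.swap)
  also have "0 \<le> \<dots>"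
    using int by (intro sum_nonneg grad_form_gram_nonneg) auto
  finally show ?thesis .
qed

section \<open>The saddle-point matrix and its energy\<close>

lemma A_rr_carrier:
  "A_rr N Ts I Q D \<in> carrier_mat (length I + (length Q + length D)) (length I + (length Q + length D))"
  unfolding A_rr_def
  by (intro carrier_append_rows append_cols_carrier A_block_carrier B_block_carrier zero_carrier_mat
      transpose_carrier_mat[THEN iffD2])

lemma A_Pi_r_carrier:
  "A_Pi_r N Ts I Q D P \<in> carrier_mat (length P) (length I + (length Q + length D))"
  unfolding A_Pi_r_def
  by (intro append_cols_carrier A_block_carrier B_block_carrier transpose_carrier_mat[THEN iffD2])

text \<open>Stiffness blocks are symmetric under exchange of their lists, and the \<open>B\<close>
  blocks face their own transposes. Transposition thus gives the same nine blocks, sorted by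
  columns, which the interchange law regroups into rows.\<close>

lemma transpose_A_rr: "transpose_mat (A_rr N Ts I Q D) = A_rr N Ts I Q D"
proof -
  note A = A_block_carrier[of N Ts] and B = B_block_carrier[of N Ts Q]
  have Bt: "transpose_mat (B_block N Ts Q us) \<in> carrier_mat (length us) (length Q)" for us
    using B by simp
  have row: "transpose_mat (X @\<^sub>c Y @\<^sub>c Z) = transpose_mat X @\<^sub>r transpose_mat Y @\<^sub>r transpose_mat Z"
    if "X \<in> carrier_mat n a" "Y \<in> carrier_mat n b" "Z \<in> carrier_mat n c"
    for X Y Z :: "real mat" and n a b c
    using that by (simp add: transpose_append_cols[of _ n a _ "b + c"] transpose_append_cols[of _ n b _ c]
        append_cols_carrier)
  note rows = append_cols_carrier[OF A append_cols_carrier[OF Bt A]]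
    append_cols_carrier[OF B append_cols_carrier[OF zero_carrier_mat B]]
  have "transpose_mat (A_rr N Ts I Q D)
      = (A_block N Ts I I @\<^sub>r B_block N Ts Q I @\<^sub>r A_block N Ts D I)
        @\<^sub>c (transpose_mat (B_block N Ts Q I) @\<^sub>r 0\<^sub>m (length Q) (length Q) @\<^sub>r transpose_mat (B_block N Ts Q D))
        @\<^sub>c (A_block N Ts I D @\<^sub>r B_block N Ts Q D @\<^sub>r A_block N Ts D D)"
    unfolding A_rr_def
      transpose_append_rows[OF rows(1) carrier_append_rows[OF rows(2) rows(1)]]
      transpose_append_rows[OF rows(2) rows(1)] row[OF A Bt A] row[OF B zero_carrier_mat B]
    by (simp add: transpose_A_block)
  also have "\<dots> = A_rr N Ts I Q D"
    unfolding A_rr_def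
      append_cols_append_rows[OF Bt A carrier_append_rows[OF zero_carrier_mat Bt] carrier_append_rows[OF B A]]
      append_cols_append_rows[OF zero_carrier_mat B Bt A]
      append_cols_append_rows[OF A append_cols_carrier[OF Bt A] carrier_append_rows[OF B A]
        carrier_append_rows[OF append_cols_carrier[OF zero_carrier_mat B] append_cols_carrier[OF Bt A]]]
      append_cols_append_rows[OF B append_cols_carrier[OF zero_carrier_mat B] A append_cols_carrier[OF Bt A]]
    ..
  finally show ?thesis .
qed

lemma transpose_A_Pi_r:
  "transpose_mat (A_Pi_r N Ts I Q D P) = A_block N Ts I P @\<^sub>r B_block N Ts Q P @\<^sub>r A_block N Ts D P"
proof -
  have Bt: "transpose_mat (B_block N Ts Q P) \<in> carrier_mat (length P) (length Q)"
    using B_block_carrier by simp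
  show ?thesis
    unfolding A_Pi_r_def
    by (simp add: transpose_append_cols[OF A_block_carrier append_cols_carrier[OF Bt A_block_carrier]]
        transpose_append_cols[OF Bt A_block_carrier] transpose_A_block)
qed

text \<open>Testing the eliminated equations with \<open>(u, - p, d)\<close> cancels all pressure terms, so that only
  the energy of the velocity \<open>(u, d, v)\<close> remains.\<close>

lemma coarse_energy:
  assumes y: "y \<in> carrier_vec (length I + (length Q + length D))" and v: "v \<in> carrier_vec (length P)"
    and elim: "A_rr N Ts I Q D *\<^sub>v y + transpose_mat (A_Pi_r N Ts I Q D P) *\<^sub>v v
      = 0\<^sub>v (length I + (length Q + length D))"
  obtains w where "w \<in> carrier_vec (length (I @ D @ P))"
    "scalar_prod v (A_Pi_r N Ts I Q D P *\<^sub>v y + A_block N Ts P P *\<^sub>v v)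
      = scalar_prod w (A_block N Ts (I @ D @ P) (I @ D @ P) *\<^sub>v w)"
proof -
  define u where "u = vec_first y (length I)"
  define p where "p = vec_first (vec_last y (length Q + length D)) (length Q)"
  define d where "d = vec_last (vec_last y (length Q + length D)) (length D)"
  have dims: "u \<in> carrier_vec (length I)" "p \<in> carrier_vec (length Q)" "d \<in> carrier_vec (length D)"
    unfolding u_def p_def d_def by auto
  have y_eq: "y = u @\<^sub>v p @\<^sub>v d"
    using y unfolding u_def p_def d_def by simp
  let ?A = "A_block N Ts" and ?B = "B_block N Ts Q"
  note car = A_block_carrier[of N Ts] B_block_carrier[of N Ts Q]
  have Av: "?A us vs *\<^sub>v x \<in> carrier_vec (length us)" if "x \<in> carrier_vec (length vs)" for us vs x
    by (rule mult_mat_vec_carrier[OF car(1) that])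
  have Bv: "?B us *\<^sub>v x \<in> carrier_vec (length Q)" if "x \<in> carrier_vec (length us)" for us x
    by (rule mult_mat_vec_carrier[OF car(2) that])
  have Bt: "transpose_mat (?B us) \<in> carrier_mat (length us) (length Q)" for us
    using car by simp
  have Btv: "transpose_mat (?B us) *\<^sub>v x \<in> carrier_vec (length us)" if "x \<in> carrier_vec (length Q)" for us x
    by (rule mult_mat_vec_carrier[OF Bt that])
  have cols: "(X @\<^sub>c Y @\<^sub>c Z) *\<^sub>v (a @\<^sub>v b @\<^sub>v c) = X *\<^sub>v a + (Y *\<^sub>v b + Z *\<^sub>v c)"
    if "X \<in> carrier_mat n na" "Y \<in> carrier_mat n nb" "Z \<in> carrier_mat n nc"
      "a \<in> carrier_vec na" "b \<in> carrier_vec nb" "c \<in> carrier_vec nc"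
    for X Y Z :: "real mat" and a b c n na nb nc
    using that append_cols_mult_vec append_cols_carrier by (metis append_carrier_vec)
  have rows: "scalar_prod (a @\<^sub>v b @\<^sub>v c) ((X @\<^sub>r Y @\<^sub>r Z) *\<^sub>v x)
      = scalar_prod a (X *\<^sub>v x) + (scalar_prod b (Y *\<^sub>v x) + scalar_prod c (Z *\<^sub>v x))"
    if "X \<in> carrier_mat na n" "Y \<in> carrier_mat nb n" "Z \<in> carrier_mat nc n" "x \<in> carrier_vec n"
      "a \<in> carrier_vec na" "b \<in> carrier_vec nb" "c \<in> carrier_vec nc"
    for X Y Z :: "real mat" and a b c x n na nb nc
  proof -
    have "(X @\<^sub>r Y @\<^sub>r Z) *\<^sub>v x = X *\<^sub>v x @\<^sub>v Y *\<^sub>v x @\<^sub>v Z *\<^sub>v x"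
      using that mat_mult_append carrier_append_rows by metis
    then show ?thesis
      using that by (simp add: scalar_prod_append[of _ na _ "nb + nc"] scalar_prod_append[of _ nb _ nc])
  qed
  note dist = scalar_prod_add_distrib[where n = "length I"] scalar_prod_add_distrib[where n = "length Q"]
    scalar_prod_add_distrib[where n = "length D"] scalar_prod_add_distrib[where n = "length P"]
  \<comment> \<open>Every transposed \<open>B\<close> term is brought to the form
    \<open>scalar_prod p (?B us *\<^sub>v a)\<close>, so that pressure terms can cancel.\<close>
  have adj: "scalar_prod a (transpose_mat (?B us) *\<^sub>v p) = scalar_prod p (?B us *\<^sub>v a)"
    if a: "a \<in> carrier_vec (length us)" for a us
    using transpose_vec_mult_scalar[OF car(2) a dims(2)] comm_scalar_prod[OF a Btv[OF dims(2)]] by simp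
  have zero: "0\<^sub>m (length Q) (length Q) *\<^sub>v p = 0\<^sub>v (length Q)"
    using dims by (intro eq_vecI) auto
  have neg: "scalar_prod (- p) x = - scalar_prod p x" if "x \<in> carrier_vec (length Q)" for x
    by (rule uminus_scalar_prod[OF dims(2) that, symmetric])
  define z where "z = u @\<^sub>v (- p) @\<^sub>v d"
  have z: "z \<in> carrier_vec (length I + (length Q + length D))"
    using dims unfolding z_def by auto
  \<comment> \<open>The couplings of \<open>p\<close> with \<open>u\<close> and with
    \<open>d\<close> each occur twice with opposite signs, because \<open>z\<close> reverses the
    sign of \<open>p\<close>.\<close>
  have "scalar_prod z (A_rr N Ts I Q D *\<^sub>v y)
      = (scalar_prod u (?A I I *\<^sub>v u) + scalar_prod p (?B I *\<^sub>v u) + scalar_prod u (?A I D *\<^sub>v d))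
      - (scalar_prod p (?B I *\<^sub>v u) + scalar_prod p (?B D *\<^sub>v d))
      + (scalar_prod d (?A D I *\<^sub>v u) + scalar_prod p (?B D *\<^sub>v d) + scalar_prod d (?A D D *\<^sub>v d))"
  proof -
    have "scalar_prod z (A_rr N Ts I Q D *\<^sub>v y)
      = scalar_prod u (?A I I *\<^sub>v u + (transpose_mat (?B I) *\<^sub>v p + ?A I D *\<^sub>v d))
      + (scalar_prod (- p) (?B I *\<^sub>v u + (0\<^sub>m (length Q) (length Q) *\<^sub>v p + ?B D *\<^sub>v d))
      + scalar_prod d (?A D I *\<^sub>v u + (transpose_mat (?B D) *\<^sub>v p + ?A D D *\<^sub>v d)))"
      unfolding z_def A_rr_def
      by (subst rows[OF _ _ _ y dims(1) _ dims(3)])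
        (use dims in \<open>auto simp: y_eq cols[OF car(1) Bt car(1) dims] cols[OF car(2) zero_carrier_mat car(2) dims]
          intro!: append_cols_carrier car Bt\<close>)
    moreover have "scalar_prod (- p) (?B I *\<^sub>v u + (0\<^sub>m (length Q) (length Q) *\<^sub>v p + ?B D *\<^sub>v d))
        = - (scalar_prod p (?B I *\<^sub>v u) + scalar_prod p (?B D *\<^sub>v d))"
      using dims Bv[OF dims(1)] Bv[OF dims(3)] by (simp add: zero dist neg)
    ultimately show ?thesis
      using dims Av Btv by (simp add: dist adj)
  qed
  moreover have "scalar_prod z (transpose_mat (A_Pi_r N Ts I Q D P) *\<^sub>v v)
      = scalar_prod u (?A I P *\<^sub>v v) - scalar_prod p (?B P *\<^sub>v v) + scalar_prod d (?A D P *\<^sub>v v)"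
    unfolding z_def transpose_A_Pi_r
    using rows[OF car(1) car(2) car(1) v dims(1) _ dims(3), of "- p"] dims Bv[OF v]
    by (simp add: neg)
  \<comment> \<open>The eliminated equations tested with \<open>z\<close>. Adding this zero to the
    coarse form below supplies the missing velocity terms and removes the last pressure term,
    \<open>scalar_prod p (?B P *\<^sub>v v)\<close>.\<close>
  moreover have "scalar_prod z (A_rr N Ts I Q D *\<^sub>v y)
      + scalar_prod z (transpose_mat (A_Pi_r N Ts I Q D P) *\<^sub>v v) = 0"
  proof -
    have "A_rr N Ts I Q D *\<^sub>v y \<in> carrier_vec (length I + (length Q + length D))"
      "transpose_mat (A_Pi_r N Ts I Q D P) *\<^sub>v v \<in> carrier_vec (length I + (length Q + length D))"
      using A_rr_carrier A_Pi_r_carrier y v by (auto intro!: mult_mat_vec_carrier)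
    from scalar_prod_add_distrib[OF z this] show ?thesis
      using z by (simp add: elim)
  qed
  moreover have "scalar_prod v (A_Pi_r N Ts I Q D P *\<^sub>v y + ?A P P *\<^sub>v v)
      = scalar_prod v (?A P I *\<^sub>v u) + scalar_prod p (?B P *\<^sub>v v) + scalar_prod v (?A P D *\<^sub>v d)
      + scalar_prod v (?A P P *\<^sub>v v)"
    unfolding A_Pi_r_def y_eq using dims v Av Btv
    by (simp add: cols[OF car(1) Bt car(1) dims] dist adj)
  moreover define w where "w = u @\<^sub>v d @\<^sub>v v"
  have "w \<in> carrier_vec (length (I @ D @ P))"
    using dims v unfolding w_def by auto
  moreover have "scalar_prod w (?A (I @ D @ P) (I @ D @ P) *\<^sub>v w)
      = (scalar_prod u (?A I I *\<^sub>v u) + scalar_prod u (?A I D *\<^sub>v d) + scalar_prod u (?A I P *\<^sub>v v))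
      + (scalar_prod d (?A D I *\<^sub>v u) + scalar_prod d (?A D D *\<^sub>v d) + scalar_prod d (?A D P *\<^sub>v v))
      + (scalar_prod v (?A P I *\<^sub>v u) + scalar_prod v (?A P D *\<^sub>v d) + scalar_prod v (?A P P *\<^sub>v v))"
  proof -
    have "?A us (I @ D @ P) *\<^sub>v w = ?A us I *\<^sub>v u + (?A us D *\<^sub>v d + ?A us P *\<^sub>v v)" for us
      unfolding A_block_append_cols w_def using cols[OF car(1) car(1) car(1) dims(1,3) v] .
    then show ?thesis
      unfolding A_block_append_rows
      using rows[OF car(1) car(1) car(1) \<open>w \<in> _\<close> dims(1,3) v] dims v Av
      by (simp add: w_def dist)
  qed
  ultimately show thesis
    using that by (simp add: w_def)
qed


section \<open>Basis fields on the subdomains and the conclusion\<close>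

section \<open>The coarse level matrix\<close>

lemma is_basis_nth:
  assumes "is_basis bs V" "k < length bs"
  shows "bs ! k \<in> V"
proof -
  have "lin_comb (unit_vec (length bs) k) bs = bs ! k"
  proof
    fix x
    have "lin_comb (unit_vec (length bs) k) bs x = (\<Sum>l<length bs. if l = k then (bs ! l) x else 0)"
      unfolding lin_comb_def by (intro sum.cong refl) (use assms(2) in auto)
    then show "lin_comb (unit_vec (length bs) k) bs x = (bs ! k) x"
      using assms(2) by simp
  qed
  then show ?thesis
    using assms(1) bij_betwE unfolding is_basis_def by (metis unit_vec_carrier)
qed

lemma is_basis_set: "is_basis bs V \<Longrightarrow> set bs \<subseteq> V"
  using is_basis_nth by (metis in_set_conv_nth subsetI)

lemma velocity_space_pw_affine: "w \<in> velocity_space T \<Longrightarrow> pw_affine (refine_mesh T) w"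
  unfolding velocity_space_def P1_def pw_affine_def by blast

lemma W_I_pw_affine:
  assumes "w \<in> W_I T N Ts"
  shows "pw_affine (refine_mesh T) w"
proof -
  obtain f where "w = (\<lambda>x. \<Sum>i<N. f i x)" "\<forall>i<N. f i \<in> velocity_space T"
    using assms unfolding W_I_def W_I_local_def by blast
  then show ?thesis
    using pw_affine_sum[of "{..<N}" _ f] velocity_space_pw_affine by simp
qed

lemma W_Gamma_pw_affine: "w \<in> W_Gamma T N Ts \<Longrightarrow> pw_affine (refine_mesh T) w"
  unfolding W_Gamma_def by (simp add: velocity_space_pw_affine)

lemma curry_broken: "i < N \<Longrightarrow> curry (broken N Ts w) i = restrict_field (\<Union>(Ts i)) w"
  unfolding broken_def by auto

text \<open>A dual field may jump across the interface, but each of its subdomain components is the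
  restriction of some field in \<open>W_Gamma\<close>, possibly a different one for each
  subdomain.\<close>

lemma W_Delta_curry:
  assumes "u \<in> W_Delta T N Ts bP \<gamma>" "i < N"
  shows "\<exists>f. pw_affine (refine_mesh T) f \<and> curry u i = restrict_field (\<Union>(Ts i)) f"
  using assms W_Gamma_pw_affine unfolding W_Delta_def W_Delta_local_def W_Gamma_local_def by blast

theorem mainTheorem3:
  fixes \<Omega> :: "point set" and T :: mesh and h H \<rho> c C \<beta> :: real
    and N :: nat and Ts :: "nat \<Rightarrow> mesh"
    and W_Pi :: "velocity set" and \<gamma> :: "nat \<Rightarrow> velocity"
    and bI bP :: "velocity list" and bQ :: "pressure list" and bD :: "broken_velocity list"
  assumes domain: "triangulated_domain \<Omega> T"
    and constants: "0 < h" "0 < H" "0 < \<rho>" "0 < c" "0 < C" "0 < \<beta>"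
    and shape: "shape_regular \<rho> T"
    and element_size: "\<forall>t\<in>T. size_of_order c C h t"
    and stable: "inf_sup_stable \<beta> \<Omega> (velocity_space T) (pressure_space T)"
    and kernel: "kernel_BT \<Omega> (velocity_space T) (pressure_space T)
                   = {q \<in> pressure_space T. \<exists>d. \<forall>x\<in>\<Omega>. q x = d}"
    and subdomains: "decomposition T N Ts"
    and subdomain_size: "\<forall>i<N. size_of_order c C H (mesh_domain (Ts i))"
    and primal: "primal_dofs T N Ts W_Pi bP \<gamma>"
    and basis_I: "is_basis bI (W_I T N Ts)"
    and basis_Q: "is_basis bQ (Q_I T N Ts)"
    and basis_D: "is_basis bD (W_Delta T N Ts bP \<gamma>)"
    and A_rr_invertible:
      "invertible_mat (A_rr N Ts (map (broken N Ts) bI) bQ bD)"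
    and A_tilde_invertible:
      "invertible_mat (A_tilde N Ts (map (broken N Ts) bI) bQ bD (map (broken N Ts) bP))"
  shows "symmetric_positive_definite
           (S_Pi N Ts (map (broken N Ts) bI) bQ bD (map (broken N Ts) bP))"
proof -
  define I where "I = map (broken N Ts) bI"
  define P where "P = map (broken N Ts) bP"
  have T: "triangle_mesh T"
    using domain unfolding triangulated_domain_def by blast
  have "set bP \<subseteq> W_Gamma T N Ts"
    using primal is_basis_set unfolding primal_dofs_def by blast
  \<comment> \<open>Interior, dual and primal basis fields share this form, so one integrability
    argument covers all their products.\<close>
  then have local_fields: "\<exists>f. pw_affine (refine_mesh T) f \<and> curry u i = restrict_field (\<Union>(Ts i)) f"
    if "u \<in> set (I @ bD @ P)" "i < N" for u i
    using that is_basis_set[OF basis_I] is_basis_set[OF basis_D] W_I_pw_affine W_Gamma_pw_affine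
      W_Delta_curry curry_broken[OF that(2)]
    unfolding I_def P_def by auto blast+
  have "set_integrable lebesgue (mesh_domain (Ts i))
      (\<lambda>x. inner (jacobian (curry u i) (at x)) (jacobian (curry w i) (at x)))"
    if i: "i < N" and u: "u \<in> set (I @ bD @ P)" and w: "w \<in> set (I @ bD @ P)" for i u w
  proof -
    obtain f g where fg: "pw_affine (refine_mesh T) f" "curry u i = restrict_field (\<Union>(Ts i)) f"
      "pw_affine (refine_mesh T) g" "curry w i = restrict_field (\<Union>(Ts i)) g"
      using local_fields[OF u i] local_fields[OF w i] by blast
    \<comment> \<open>The elements of a subdomain belong to \<open>T\<close>, so the refinement of
      the whole mesh covers it.\<close>
    have "\<Union>(Ts i) \<subseteq> \<Union>(refine_mesh T)"
      using refine_mesh_covers[OF T] subdomains i unfolding decomposition_def by blast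
    then show ?thesis
      unfolding fg(2,4) mesh_domain_def
      using finite_refine_mesh[OF T] refine_mesh_convex_compact fg(1,3)
      by (intro grad_form_integrable) auto
  qed
  then have "0 \<le> scalar_prod w (A_block N Ts (I @ bD @ P) (I @ bD @ P) *\<^sub>v w)"
    if "w \<in> carrier_vec (length (I @ bD @ P))" for w
    using that by (intro A_block_positive_semidefinite)
  \<comment> \<open>The energy identity turns semidefiniteness of the velocity block into the
    hypothesis on eliminated pairs in the Schur complement lemma.\<close>
  then have "0 \<le> scalar_prod v (A_Pi_r N Ts I bQ bD P *\<^sub>v y + A_block N Ts P P *\<^sub>v v)"
    if "y \<in> carrier_vec (length I + (length bQ + length bD))" "v \<in> carrier_vec (length P)"
      "A_rr N Ts I bQ bD *\<^sub>v y + transpose_mat (A_Pi_r N Ts I bQ bD P) *\<^sub>v v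
        = 0\<^sub>v (length I + (length bQ + length bD))" for y v
    using coarse_energy[OF that] by metis
  then have "symmetric_positive_definite (S_Pi N Ts I bQ bD P)"
    unfolding S_Pi_def A_r_Pi_def
    using A_rr_invertible A_tilde_invertible
    by (intro schur_complement_positive_definite[OF A_rr_carrier transpose_A_rr _ A_Pi_r_carrier
          A_block_carrier transpose_A_block])
      (simp_all add: I_def P_def A_tilde_def A_r_Pi_def)
  then show ?thesis
    unfolding I_def P_def .
qed

end
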